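(* Let $\lambda\ge 0$ and $\mu,\nu,\kappa>0$, and put $\theta=\lambda/\nu$, $\gamma=\kappa/\nu$, $\eta=\mu/\nu$. For $k=0,1,2,\dots$ let $$A_k=\int_0^1\gamma(1-t)^{\gamma-1}t^{\eta-1+k}e^{-\theta t}\,dt .$$ Then the stationary distribution $\pi=(\pi_k)_{k\ge0}$ of the M/M/1+M queue with random resetting (the continuous-time Markov chain on $\mathbb{Z}_+$ described in the context) is given by $$\pi_k=\frac{\theta^k}{\prod_{i=0}^{k-1}(i+\eta)}\cdot\frac{\gamma A_k}{(\gamma+\theta)A_0-\theta A_1},\qquad k=0,1,2,\dots .$$
   Context: The M/M/1+M queue with random resetting (first-come first-served; arrival rate $\lambda$, service rate $\mu$, abandonment/patience rate $\nu$, resetting rate $\kappa$) is the continuous-time Markov chain $\{X(t):t\ge0\}$ on $\mathbb{Z}_+=\{0,1,2,\dots\}$ with the following transition mechanisms: from $i\ge0$ to $i+1$ at rate $\lambda$ (arrival); from $i\ge1$ to $i-1$ at rate $\mu+(i-1)\nu$ (departure); from $i\ge1$ to $0$ at rate $\kappa$ (resetting). (From state $1$ to $0$ the departure and resetting rates add up.) This chain has a unique stationary distribution. Conventions: empty products equal $1$ and $\theta^0=1$. *)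

theory Defs
  imports "HOL-Probability.Probability"
begin

text \<open>
  A time-homogeneous continuous-time Markov chain on \<open>\<nat>\<close> is given by its transition function:
  \<open>P t i\<close> is the law of \<open>X (s + t)\<close> given \<open>X s = i\<close>. Only times \<open>t \<ge> 0\<close> matter. Taking values
  in \<open>pmf\<close> makes every \<open>P t\<close> a stochastic matrix.
\<close>

definition transition_function :: "(real \<Rightarrow> nat \<Rightarrow> nat pmf) \<Rightarrow> bool" where
  "transition_function P \<longleftrightarrow>
     (\<forall>i. P 0 i = return_pmf i) \<and>
     (\<forall>s t i. s \<ge> 0 \<longrightarrow> t \<ge> 0 \<longrightarrow> P (s + t) i = bind_pmf (P s i) (P t))"

text \<open>
  \<open>q i j\<close> is the rate of jumping from \<open>i\<close> to \<open>j\<close>, for \<open>i \<noteq> j\<close>; the diagonal of \<open>q\<close> is ignored.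
  The second conjunct says that the Q-matrix \<open>P' 0\<close> is stable and conservative: state \<open>i\<close> is
  left at the finite total rate \<open>\<Sum>j\<noteq>i. q i j\<close>.
\<close>

definition has_jump_rates :: "(real \<Rightarrow> nat \<Rightarrow> nat pmf) \<Rightarrow> (nat \<Rightarrow> nat \<Rightarrow> real) \<Rightarrow> bool" where
  "has_jump_rates P q \<longleftrightarrow>
     (\<forall>i j. i \<noteq> j \<longrightarrow> ((\<lambda>h. pmf (P h i) j / h) \<longlongrightarrow> q i j) (at_right 0)) \<and>
     (\<forall>i. q i summable_on (- {i}) \<and>
          ((\<lambda>h. (1 - pmf (P h i) i) / h) \<longlongrightarrow> (\<Sum>\<^sub>\<infinity>j\<in>- {i}. q i j)) (at_right 0))"

definition ctmc_with_rates :: "(nat \<Rightarrow> nat \<Rightarrow> real) \<Rightarrow> (real \<Rightarrow> nat \<Rightarrow> nat pmf) \<Rightarrow> bool" where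
  "ctmc_with_rates q P \<longleftrightarrow> transition_function P \<and> has_jump_rates P q"

definition stationary_distribution :: "(real \<Rightarrow> nat \<Rightarrow> nat pmf) \<Rightarrow> nat pmf \<Rightarrow> bool" where
  "stationary_distribution P p \<longleftrightarrow> (\<forall>t\<ge>0. bind_pmf p (P t) = p)"

text \<open>
  Arrivals, departures and resets (\<open>lam\<close> is the arrival rate). The summands are not exclusive:
  from state 1 to state 0 the departure and reset rates add up.
\<close>

definition reset_queue_rate :: "real \<Rightarrow> real \<Rightarrow> real \<Rightarrow> real \<Rightarrow> nat \<Rightarrow> nat \<Rightarrow> real" where
  "reset_queue_rate lam \<mu> \<nu> \<kappa> i j =
     (if j = i + 1 then lam else 0) +
     (if i \<ge> 1 \<and> j = i - 1 then \<mu> + (real i - 1) * \<nu> else 0) +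
     (if i \<ge> 1 \<and> j = 0 then \<kappa> else 0)"

definition A_integral :: "real \<Rightarrow> real \<Rightarrow> real \<Rightarrow> nat \<Rightarrow> real" where
  "A_integral \<theta> \<gamma> \<eta> k =
     (LBINT t:{0<..<1}. \<gamma> * (1 - t) powr (\<gamma> - 1) * t powr (\<eta> - 1 + real k) * exp (- \<theta> * t))"

end

theory Submission
  imports Defs "HOL-Real_Asymp.Real_Asymp"
begin

text \<open>
  Existence: let \<open>\<pi>\<close> be given by the formula and \<open>N\<close> be its denominator. Integration by parts in
  the integrals \<open>A\<close> shows that \<open>\<theta> * w k * (A k - A (k + 1)) / N\<close>, with
  \<open>w k = \<theta> ^ k / (\<Prod>i<k. i + \<eta>)\<close>, is the tail \<open>\<Sum>i>k. \<pi> i\<close>. So \<open>\<pi>\<close> is a probability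
  distribution, and it balances the flow across every cut between \<open>{0..k}\<close> and \<open>{k + 1..}\<close>.
  Since the exit rates are \<open>\<pi>\<close>-integrable, \<open>\<pi>\<close> is invariant under every transition function with
  the given rates at time \<open>0\<close>. Uniqueness: state \<open>0\<close> is reached from every state, so the
  difference of two invariant laws cannot take both signs.
\<close>

section \<open>Expectations, bound laws and signed differences of \<open>pmf\<close>s\<close>

lemma integrable_measure_pmf_bounded:
  fixes f :: "'a \<Rightarrow> real"
  assumes "\<And>x. \<bar>f x\<bar> \<le> B"
  shows "integrable (measure_pmf p) f"
  using assms by (intro measure_pmf.integrable_const_bound[where B = B]) auto

text \<open>Mapping along membership in \<open>B\<close> turns the event into the single point
  \<open>True\<close>, where \<open>pmf_bind\<close> applies.\<close>

lemma measure_bind_pmf: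
  "measure (measure_pmf (bind_pmf p K)) B = (\<integral>x. measure (measure_pmf (K x)) B \<partial>measure_pmf p)"
proof -
  have *: "measure (measure_pmf q) B = pmf (map_pmf (\<lambda>x. x \<in> B) q) True" for q
    by (simp add: pmf_map vimage_def)
  show ?thesis
    unfolding * map_bind_pmf pmf_bind ..
qed

text \<open>Treats \<open>p - p'\<close> as a density for counting measure, so that sign arguments
  about two laws become arguments about one integrand.\<close>

lemma integral_pmf_diff:
  fixes f :: "'a \<Rightarrow> real"
  assumes "\<And>x. \<bar>f x\<bar> \<le> B"
  shows "integrable (count_space UNIV) (\<lambda>x. (pmf p x - pmf p' x) * f x)"
    and "(\<integral>x. (pmf p x - pmf p' x) * f x \<partial>count_space UNIV) =
      measure_pmf.expectation p f - measure_pmf.expectation p' f"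
proof -
  have i: "integrable (count_space UNIV) (\<lambda>x. pmf r x * f x)" for r
    using integrable_measure_pmf_bounded[OF assms, of r]
    by (simp add: measure_pmf_eq_density integrable_density)
  have e: "measure_pmf.expectation r f = (\<integral>x. pmf r x * f x \<partial>count_space UNIV)" for r
    by (simp add: measure_pmf_eq_density integral_density)
  show "integrable (count_space UNIV) (\<lambda>x. (pmf p x - pmf p' x) * f x)"
    using i[of p] i[of p'] by (simp add: left_diff_distrib)
  show "(\<integral>x. (pmf p x - pmf p' x) * f x \<partial>count_space UNIV) =
      measure_pmf.expectation p f - measure_pmf.expectation p' f"
    using i[of p] i[of p'] by (simp add: left_diff_distrib e)
qed

text \<open>Both masses are 1, so the nonnegative difference has integral 0 and vanishes at every
  point.\<close>

lemma pmf_eqI_le: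
  assumes "\<And>x. pmf p x \<le> pmf q x"
  shows "p = q"
proof (rule pmf_eqI)
  fix x
  have "(\<lambda>x. (pmf q x - pmf p x) * 1) = (\<lambda>x. pmf q x - pmf p x)" by simp
  then have "integrable (count_space UNIV) (\<lambda>x. pmf q x - pmf p x)"
    "(\<integral>x. pmf q x - pmf p x \<partial>count_space UNIV) = 0"
    using integral_pmf_diff[of "\<lambda>_. 1" 1 q p] by simp_all
  then have "AE x in count_space UNIV. pmf q x - pmf p x = 0"
    using assms by (subst (asm) integral_nonneg_eq_0_iff_AE) auto
  then show "pmf p x = pmf q x"
    by (simp add: AE_count_space)
qed

section \<open>Uniqueness of the invariant law\<close>

text \<open>
  Put \<open>d = p - p'\<close> and \<open>B = {d > 0}\<close>. By invariance the terms \<open>d i * (1\<^sub>B i - P h i B)\<close>, which are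
  nonnegative, sum to \<open>0\<close>. So \<open>P h i B\<close> is \<open>1\<close> where \<open>d > 0\<close> and \<open>0\<close> where \<open>d < 0\<close>; as \<open>z\<close> is
  accessible from everywhere, only one of the two signs occurs.
\<close>
lemma stationary_distribution_unique:
  assumes pos: "\<And>i. eventually (\<lambda>h. pmf (P h i) z > 0) (at_right 0)"
    and p: "stationary_distribution P p" and p': "stationary_distribution P p'"
  shows "p = p'"
proof -
  define d where "d i = pmf p i - pmf p' i" for i
  define B where "B = {i. d i > 0}"
  define K where "K h i = measure (measure_pmf (P h i)) B" for h i
  have zero: "d i * (indicator B i - K h i) = 0" if "h \<ge> 0" for h i
  proof -
    have inv: "bind_pmf p (P h) = p" "bind_pmf p' (P h) = p'"
      using p p' that by (auto simp: stationary_distribution_def)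
    have ind: "measure_pmf.expectation r (indicator B) = measure_pmf.expectation r (K h)"
      if "bind_pmf r (P h) = r" for r
      using measure_bind_pmf[of r "P h" B] that by (simp add: K_def[abs_def])
    have bd: "\<bar>indicator B i - K h i\<bar> \<le> 1" for i
      by (auto simp: K_def indicator_def)
    have iK: "integrable (measure_pmf r) (K h)" for r
      by (rule integrable_measure_pmf_bounded[where B = 1]) (simp add: K_def)
    have iB: "integrable (measure_pmf r) (indicator B :: nat \<Rightarrow> real)" for r
      by (rule integrable_measure_pmf_bounded[where B = 1]) (simp add: indicator_def)
    have E: "measure_pmf.expectation r (\<lambda>i. indicator B i - K h i) = 0"
      if "bind_pmf r (P h) = r" for r
      using ind[OF that] iK iB by simp
    have "AE i in count_space UNIV. d i * (indicator B i - K h i) = 0"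
    proof (subst integral_nonneg_eq_0_iff_AE[symmetric])
      show "integrable (count_space UNIV) (\<lambda>i. d i * (indicator B i - K h i))"
        unfolding d_def by (rule integral_pmf_diff[OF bd])
      show "AE i in count_space UNIV. 0 \<le> d i * (indicator B i - K h i)"
        by (auto simp: B_def indicator_def K_def mult_le_0_iff intro!: AE_I2 mult_nonneg_nonneg)
      show "(\<integral>i. d i * (indicator B i - K h i) \<partial>count_space UNIV) = 0"
        unfolding d_def by (subst integral_pmf_diff(2)[OF bd]) (simp add: E inv)
    qed
    then show ?thesis by (simp add: AE_count_space)
  qed
  have access: "\<exists>h\<ge>0. pmf (P h i) z > 0" for i
    using eventually_happens[OF eventually_conj[OF pos[of i] eventually_at_right_less[of 0]]]
    by (auto intro: less_imp_le)
  show "p = p'"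
  proof (cases "z \<in> B")
    case True
    \<comment> \<open>If \<open>d i < 0\<close>, then \<open>K h i\<close> would be 0, although
      \<open>B\<close> contains the accessible point \<open>z\<close>.\<close>
    have "d i \<ge> 0" for i
    proof (rule ccontr)
      assume "\<not> d i \<ge> 0"
      obtain h where h: "h \<ge> 0" "pmf (P h i) z > 0" using access by blast
      have "pmf (P h i) z \<le> K h i"
        unfolding K_def pmf.rep_eq using True by (intro measure_pmf.finite_measure_mono) auto
      with zero[OF h(1), of i] \<open>\<not> d i \<ge> 0\<close> h show False by (auto simp: B_def)
    qed
    then show ?thesis using pmf_eqI_le[of p' p] by (simp add: d_def)
  next
    case False
    \<comment> \<open>If \<open>d i > 0\<close>, then \<open>K h i\<close> would be 1, leaving no
      mass for \<open>z\<close> outside \<open>B\<close>.\<close>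
    have "d i \<le> 0" for i
    proof (rule ccontr)
      assume i: "\<not> d i \<le> 0"
      obtain h where h: "h \<ge> 0" "pmf (P h i) z > 0" using access by blast
      have "pmf (P h i) z + K h i = measure (measure_pmf (P h i)) (insert z B)"
        unfolding K_def pmf.rep_eq using False
        by (subst measure_pmf.finite_measure_Union[symmetric]) auto
      also have "\<dots> \<le> 1" by simp
      finally show False using zero[OF h(1), of i] i h by (auto simp: B_def)
    qed
    then show ?thesis using pmf_eqI_le[of p p'] by (simp add: d_def)
  qed
qed

section \<open>From rates at time 0 to invariance at all times\<close>

text \<open>The exit probability is subadditive in time, so its slope at \<open>0\<close> is its largest slope.\<close>
lemma exit_probability_le:
  assumes "transition_function P"
    and lim: "((\<lambda>h. (1 - pmf (P h i) i) / h) \<longlongrightarrow> c) (at_right 0)"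
    and "h > 0"
  shows "1 - pmf (P h i) i \<le> c * h"
proof -
  define a where "a h = 1 - pmf (P h i) i" for h
  \<comment> \<open>Chapman-Kolmogorov, keeping only the intermediate state
    \<open>i\<close>.\<close>
  have mult: "pmf (P s i) i * pmf (P t i) i \<le> pmf (P (s + t) i) i" if "s \<ge> 0" "t \<ge> 0" for s t
  proof -
    have "pmf (P s i) i * pmf (P t i) i = (\<integral>k. indicator {i} k * pmf (P t i) i \<partial>measure_pmf (P s i))"
      by (simp add: pmf.rep_eq)
    also have "\<dots> \<le> (\<integral>k. pmf (P t k) i \<partial>measure_pmf (P s i))"
      by (intro integral_mono integrable_measure_pmf_bounded[where B = 1])
         (auto simp: indicator_def pmf_le_1)
    also have "\<dots> = pmf (P (s + t) i) i"
      using assms(1) that by (simp add: transition_function_def pmf_bind)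
    finally show ?thesis .
  qed
  have sub: "a (s + t) \<le> a s + a t" if "s \<ge> 0" "t \<ge> 0" for s t
  proof -
    have "0 \<le> a s * a t" by (simp add: a_def pmf_le_1)
    with mult[OF that] show ?thesis by (simp add: a_def algebra_simps)
  qed
  have a0: "a 0 = 0" using assms(1) by (simp add: a_def transition_function_def)
  have le: "a (real n * s) \<le> real n * a s" if "s \<ge> 0" for n s
  proof (induction n)
    case (Suc n)
    have "a (real (Suc n) * s) \<le> a (real n * s) + a s"
      using sub[of "real n * s" s] that by (simp add: algebra_simps)
    with Suc show ?case by (simp add: algebra_simps)
  qed (simp add: a0)
  have "filterlim (\<lambda>n. h / real (Suc n)) (at_right 0) sequentially"
    using \<open>h > 0\<close> by real_asymp
  from filterlim_compose[OF lim this]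
  have "(\<lambda>n. a (h / real (Suc n)) / (h / real (Suc n))) \<longlonglongrightarrow> c"
    by (simp add: a_def)
  moreover have "a h / h \<le> a (h / real (Suc n)) / (h / real (Suc n))" for n
    using le[of "h / real (Suc n)" "Suc n"] \<open>h > 0\<close>
    by (simp add: divide_right_mono mult.commute)
  ultimately have "a h / h \<le> c"
    by (intro LIMSEQ_le_const) auto
  with \<open>h > 0\<close> show ?thesis by (simp add: a_def field_simps)
qed

text \<open>
  \<open>e i h\<close> bounds the error of the first-order approximation \<open>u i + h * (Q u) i\<close> to
  \<open>P h u i\<close>, uniformly over all \<open>u\<close> with values in \<open>[0, 1]\<close>. The transition function need not be
  differentiated at positive times: over \<open>n\<close> steps of length \<open>t / n\<close> the errors add up to
  \<open>n * E (e (t / n))\<close>, which tends to \<open>0\<close> by dominated convergence.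
\<close>
lemma stationary_distributionI:
  fixes S :: "nat \<Rightarrow> nat set"
  assumes P: "ctmc_with_rates q P"
    and S: "\<And>i. finite (S i)" "\<And>i. i \<notin> S i" "\<And>i j. j \<notin> S i \<Longrightarrow> j \<noteq> i \<Longrightarrow> q i j = 0"
    and int: "integrable (measure_pmf p) (\<lambda>i. \<Sum>j\<in>S i. q i j)"
    and bal: "\<And>u. (\<And>k. 0 \<le> u k \<and> u k \<le> 1) \<Longrightarrow>
      measure_pmf.expectation p (\<lambda>i. \<Sum>j\<in>S i. q i j * (u j - u i)) = 0"
  shows "stationary_distribution P p"
proof -
  have tr: "transition_function P" and jr: "has_jump_rates P q"
    using P by (auto simp: ctmc_with_rates_def)
  define c where "c i = (\<Sum>j\<in>S i. q i j)" for i
  have lim: "((\<lambda>h. pmf (P h i) j / h) \<longlongrightarrow> q i j) (at_right 0)" if "i \<noteq> j" for i j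
    using jr that by (simp add: has_jump_rates_def)
  have "(\<Sum>\<^sub>\<infinity>j\<in>- {i}. q i j) = c i" for i
  proof -
    have "(\<Sum>\<^sub>\<infinity>j\<in>- {i}. q i j) = (\<Sum>\<^sub>\<infinity>j\<in>S i. q i j)"
      using S by (intro infsum_cong_neutral) auto
    then show ?thesis by (simp add: c_def S)
  qed
  then have limc: "((\<lambda>h. (1 - pmf (P h i) i) / h) \<longlongrightarrow> c i) (at_right 0)" for i
    using jr by (simp add: has_jump_rates_def)
  \<comment> \<open>Off the diagonal the rates are limits of nonnegative quotients.\<close>
  have q0: "q i j \<ge> 0" if "i \<noteq> j" for i j
    by (rule tendsto_lowerbound[OF lim[OF that]])
       (auto intro!: eventually_at_rightI[of 0 1])
  have q0S: "q i j \<ge> 0" if "j \<in> S i" for i j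
    using that S(2) by (intro q0) auto
  \<comment> \<open>The first sum is the error over the direct targets; the remaining term is the
    probability of landing outside \<open>insert i (S i)\<close>, as \<open>out\<close>
    shows.\<close>
  define e where "e i h = (\<Sum>j\<in>S i. \<bar>pmf (P h i) j - h * q i j\<bar>) +
    (1 - pmf (P h i) i - (\<Sum>j\<in>S i. pmf (P h i) j))" for i h
  have out: "1 - pmf (P h i) i - (\<Sum>j\<in>S i. pmf (P h i) j) = measure (measure_pmf (P h i)) (- insert i (S i))"
    for i h
  proof -
    have "measure (measure_pmf (P h i)) (- insert i (S i)) = 1 - measure (measure_pmf (P h i)) (insert i (S i))"
      by (subst measure_pmf.prob_compl[symmetric]) (auto simp: Compl_eq_Diff_UNIV)
    also have "measure (measure_pmf (P h i)) (insert i (S i)) = (\<Sum>j\<in>insert i (S i). pmf (P h i) j)"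
      using S by (intro measure_measure_pmf_finite) auto
    finally show ?thesis using S by simp
  qed
  have e0: "e i h \<ge> 0" for i h
    unfolding e_def out by (auto intro!: add_nonneg_nonneg sum_nonneg)
  \<comment> \<open>The landing probabilities in \<open>S i\<close> cancel between the two parts of
    \<open>e\<close>, leaving the exit probability plus \<open>h * c i\<close>. The result is the
    integrable majorant of \<open>e i h / h\<close>.\<close>
  have ele: "e i h \<le> 2 * h * c i" if "h > 0" for i h
  proof -
    have "(\<Sum>j\<in>S i. \<bar>pmf (P h i) j - h * q i j\<bar>) \<le> (\<Sum>j\<in>S i. pmf (P h i) j + h * q i j)"
    proof (rule sum_mono)
      fix j assume "j \<in> S i"
      then have "h * q i j \<ge> 0" using q0S that by auto
      then show "\<bar>pmf (P h i) j - h * q i j\<bar> \<le> pmf (P h i) j + h * q i j"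
        using pmf_nonneg[of "P h i" j] by linarith
    qed
    also have "\<dots> = (\<Sum>j\<in>S i. pmf (P h i) j) + h * c i"
      by (simp add: sum.distrib c_def sum_distrib_left)
    finally show ?thesis
      using exit_probability_le[OF tr limc that, of i] by (simp add: e_def algebra_simps)
  qed
  have elim: "((\<lambda>h. e i h / h) \<longlongrightarrow> 0) (at_right 0)" for i
  proof -
    have "((\<lambda>h. (\<Sum>j\<in>S i. \<bar>pmf (P h i) j / h - q i j\<bar>) +
        ((1 - pmf (P h i) i) / h - (\<Sum>j\<in>S i. pmf (P h i) j / h))) \<longlongrightarrow>
        (\<Sum>j\<in>S i. \<bar>q i j - q i j\<bar>) + (c i - (\<Sum>j\<in>S i. q i j))) (at_right 0)"
      using S(2) by (intro tendsto_intros limc lim) auto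
    then have "((\<lambda>h. (\<Sum>j\<in>S i. \<bar>pmf (P h i) j / h - q i j\<bar>) +
        ((1 - pmf (P h i) i) / h - (\<Sum>j\<in>S i. pmf (P h i) j / h))) \<longlongrightarrow> 0) (at_right 0)"
      by (simp add: c_def)
    then show ?thesis
    proof (rule Lim_transform_eventually)
      show "eventually (\<lambda>h. (\<Sum>j\<in>S i. \<bar>pmf (P h i) j / h - q i j\<bar>) +
        ((1 - pmf (P h i) i) / h - (\<Sum>j\<in>S i. pmf (P h i) j / h)) = e i h / h) (at_right 0)"
        using eventually_at_right_less[of 0]
      proof eventually_elim
        case (elim h)
        have "\<bar>pmf (P h i) j / h - q i j\<bar> = \<bar>pmf (P h i) j - h * q i j\<bar> / h" for j
        proof -
          have "pmf (P h i) j / h - q i j = (pmf (P h i) j - h * q i j) / h"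
            using elim by (simp add: field_simps)
          then show ?thesis using elim by simp
        qed
        then show ?case
          by (simp add: e_def add_divide_distrib diff_divide_distrib sum_divide_distrib)
      qed
    qed
  qed
  have step: "\<bar>measure_pmf.expectation (P h i) u - u i - h * (\<Sum>j\<in>S i. q i j * (u j - u i))\<bar> \<le> e i h"
    if u: "\<And>k. 0 \<le> u k \<and> u k \<le> 1" for u h i
  proof -
    \<comment> \<open>On \<open>?T\<close> the expectation is a finite sum, compared with the rates
      term by term; off \<open>?T\<close> the bound 1 on differences of \<open>u\<close> leaves only
      the escaping mass.\<close>
    let ?T = "insert i (S i)"
    have d1: "\<bar>u k - u i\<bar> \<le> 1" for k using u[of k] u[of i] by linarith
    have iu: "integrable (measure_pmf (P h i)) u"
      by (rule integrable_measure_pmf_bounded[where B = 1]) (use u in auto)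
    have i1: "integrable (measure_pmf (P h i)) (\<lambda>k. indicator ?T k * (u k - u i))"
      and i2: "integrable (measure_pmf (P h i)) (\<lambda>k. indicator (- ?T) k * (u k - u i))"
      by (rule integrable_measure_pmf_bounded[where B = 1]; use d1 in \<open>auto simp: indicator_def\<close>)+
    have "measure_pmf.expectation (P h i) u - u i = measure_pmf.expectation (P h i) (\<lambda>k. u k - u i)"
      using iu by simp
    also have "\<dots> = measure_pmf.expectation (P h i)
      (\<lambda>k. indicator ?T k * (u k - u i) + indicator (- ?T) k * (u k - u i))"
      by (intro Bochner_Integration.integral_cong) (auto simp: indicator_def)
    also have "\<dots> = measure_pmf.expectation (P h i) (\<lambda>k. indicator ?T k * (u k - u i)) +
      measure_pmf.expectation (P h i) (\<lambda>k. indicator (- ?T) k * (u k - u i))" (is "_ = _ + ?R")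
      using i1 i2 by simp
    also have "measure_pmf.expectation (P h i) (\<lambda>k. indicator ?T k * (u k - u i)) =
      (\<Sum>k\<in>?T. pmf (P h i) k * (u k - u i))"
      using S by (subst integral_measure_pmf[of ?T]) (auto simp: indicator_def split: if_splits)
    also have "\<dots> = (\<Sum>k\<in>S i. pmf (P h i) k * (u k - u i))"
      using S by simp
    finally have "measure_pmf.expectation (P h i) u - u i - h * (\<Sum>j\<in>S i. q i j * (u j - u i)) =
      (\<Sum>j\<in>S i. (pmf (P h i) j - h * q i j) * (u j - u i)) + ?R"
      by (simp only: left_diff_distrib sum_subtractf sum_distrib_left mult.assoc)
    moreover have "\<bar>\<Sum>j\<in>S i. (pmf (P h i) j - h * q i j) * (u j - u i)\<bar> \<le>
      (\<Sum>j\<in>S i. \<bar>pmf (P h i) j - h * q i j\<bar>)"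
    proof (intro order_trans[OF sum_abs] sum_mono)
      fix j show "\<bar>(pmf (P h i) j - h * q i j) * (u j - u i)\<bar> \<le> \<bar>pmf (P h i) j - h * q i j\<bar>"
        using d1[of j] by (simp add: abs_mult mult_left_le)
    qed
    moreover have "\<bar>?R\<bar> \<le> measure_pmf.expectation (P h i) (indicator (- ?T))"
    proof (rule order_trans[OF integral_abs_bound integral_mono])
      show "integrable (measure_pmf (P h i)) (indicator (- ?T) :: nat \<Rightarrow> real)"
        by (rule integrable_measure_pmf_bounded[where B = 1]) (simp add: indicator_def)
      show "\<bar>indicator (- ?T) k * (u k - u i)\<bar> \<le> indicator (- ?T) k" for k
        using d1[of k] by (simp add: indicator_def)
    qed (rule integrable_abs[OF i2])
    ultimately show ?thesis
      unfolding e_def out by simp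
  qed
  define \<epsilon> where "\<epsilon> h = measure_pmf.expectation p (\<lambda>i. e i h)" for h
  have ie: "integrable (measure_pmf p) (\<lambda>i. e i h)" if "h > 0" for h
  proof (rule Bochner_Integration.integrable_bound)
    show "integrable (measure_pmf p) (\<lambda>i. 2 * h * c i)"
      using int by (simp add: c_def)
    have "norm (e i h) \<le> norm (2 * h * c i)" for i
      using ele[OF that, of i] e0[of i h] by simp
    then show "AE i in measure_pmf p. norm (e i h) \<le> norm (2 * h * c i)" by simp
  qed simp
  have one: "\<bar>pmf (bind_pmf p (P (h + t))) j - pmf (bind_pmf p (P t)) j\<bar> \<le> \<epsilon> h"
    if "h > 0" "t \<ge> 0" for h t j
  proof -
    \<comment> \<open>Taking the short step first makes the remaining evolution over
      \<open>t\<close> the test function \<open>u\<close>. Then \<open>bal\<close> removes the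
      first-order term, and the error bound does not depend on \<open>t\<close>.\<close>
    define u where "u k = pmf (P t k) j" for k
    have u: "0 \<le> u k \<and> u k \<le> 1" for k by (simp add: u_def pmf_le_1)
    have iu: "integrable (measure_pmf r) u" for r
      by (rule integrable_measure_pmf_bounded[where B = 1]) (use u in auto)
    have "measure_pmf.expectation (P h i) u = pmf (P (h + t) i) j" for i
      using tr that by (simp add: transition_function_def pmf_bind u_def[abs_def])
    then have iP: "integrable (measure_pmf p) (\<lambda>i. measure_pmf.expectation (P h i) u)"
      and eq: "pmf (bind_pmf p (P (h + t))) j = measure_pmf.expectation p (\<lambda>i. measure_pmf.expectation (P h i) u)"
      by (auto simp: pmf_bind pmf_le_1 intro!: integrable_measure_pmf_bounded[where B = 1])
    have eq': "pmf (bind_pmf p (P t)) j = measure_pmf.expectation p u"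
      by (simp add: pmf_bind u_def[abs_def])
    let ?Q = "\<lambda>i. \<Sum>j\<in>S i. q i j * (u j - u i)"
    have iQ: "integrable (measure_pmf p) ?Q"
    proof (rule Bochner_Integration.integrable_bound[OF int])
      have "\<bar>?Q i\<bar> \<le> (\<Sum>j\<in>S i. q i j)" for i
      proof (intro order_trans[OF sum_abs] sum_mono)
        fix j assume "j \<in> S i"
        moreover have "\<bar>u j - u i\<bar> \<le> 1" using u[of j] u[of i] by linarith
        ultimately show "\<bar>q i j * (u j - u i)\<bar> \<le> q i j"
          using q0S by (simp add: abs_mult mult_left_le)
      qed
      then show "AE i in measure_pmf p. norm (?Q i) \<le> norm (\<Sum>j\<in>S i. q i j)"
        by (auto intro!: AE_I2 order_trans[OF _ abs_ge_self])
    qed simp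
    have "pmf (bind_pmf p (P (h + t))) j - pmf (bind_pmf p (P t)) j =
      measure_pmf.expectation p (\<lambda>i. measure_pmf.expectation (P h i) u - u i - h * ?Q i)"
      using iP iu iQ bal[OF u] by (simp add: eq eq')
    also have "\<bar>\<dots>\<bar> \<le> \<epsilon> h"
      unfolding \<epsilon>_def
      by (rule order_trans[OF integral_abs_bound integral_mono])
         (use iP iu iQ ie[OF that(1)] step[OF u] in auto)
    finally show ?thesis .
  qed
  show ?thesis
    unfolding stationary_distribution_def
  proof (intro allI impI pmf_eqI)
    fix t :: real and j assume "t \<ge> 0"
    have P0: "bind_pmf p (P 0) = p"
      using tr by (simp add: transition_function_def bind_return_pmf' cong: bind_pmf_cong)
    show "pmf (bind_pmf p (P t)) j = pmf p j"
    proof (cases "t = 0")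
      case False
      with \<open>t \<ge> 0\<close> have "t > 0" by simp
      have many: "\<bar>pmf (bind_pmf p (P (real n * h))) j - pmf p j\<bar> \<le> real n * \<epsilon> h" if "h > 0" for n h
      proof (induction n)
        case (Suc n)
        have "\<bar>pmf (bind_pmf p (P (h + real n * h))) j - pmf (bind_pmf p (P (real n * h))) j\<bar> \<le> \<epsilon> h"
          using that by (intro one) auto
        with Suc show ?case by (simp add: algebra_simps)
      qed (simp add: P0)
      define h where "h n = t / real (Suc n)" for n
      have h: "h n > 0" for n using \<open>t > 0\<close> by (simp add: h_def)
      have "filterlim h (at_right 0) sequentially"
        using \<open>t > 0\<close> unfolding h_def by real_asymp
      then have "(\<lambda>n. e i (h n) / h n) \<longlonglongrightarrow> 0" for i
        using filterlim_compose[OF elim] by blast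
      then have "(\<lambda>n. measure_pmf.expectation p (\<lambda>i. e i (h n) / h n)) \<longlonglongrightarrow>
          measure_pmf.expectation p (\<lambda>_. 0)"
      proof (intro integral_dominated_convergence[where w = "\<lambda>i. 2 * c i"])
        show "AE i in measure_pmf p. norm (e i (h n) / h n) \<le> 2 * c i" for n
          using ele[OF h, of _ n] e0 h[of n] by (intro AE_I2) (simp add: field_simps)
      qed (use int in \<open>auto simp: c_def\<close>)
      then have "(\<lambda>n. t * (\<epsilon> (h n) / h n)) \<longlonglongrightarrow> t * 0"
        by (intro tendsto_intros) (simp add: \<epsilon>_def)
      \<comment> \<open>\<open>Suc n\<close> steps of length \<open>h n\<close> make up exactly
        \<open>t\<close>.\<close>
      moreover have "\<bar>pmf (bind_pmf p (P t)) j - pmf p j\<bar> \<le> t * (\<epsilon> (h n) / h n)" for n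
        using many[OF h, of "Suc n" n] \<open>t > 0\<close> by (simp add: h_def mult.commute)
      ultimately have "\<bar>pmf (bind_pmf p (P t)) j - pmf p j\<bar> \<le> 0"
        by (intro LIMSEQ_le_const[where X = "\<lambda>n. t * (\<epsilon> (h n) / h n)"]) auto
      then show ?thesis by simp
    qed (simp add: P0)
  qed
qed

section \<open>The integrals \<open>A\<close>\<close>

lemma set_integrable_A_integrand:
  fixes \<theta> \<gamma> \<eta> :: real
  assumes "\<theta> \<ge> 0" "\<gamma> > 0" "\<eta> > 0"
  shows "set_integrable lborel {0<..<1}
    (\<lambda>t. \<gamma> * (1 - t) powr (\<gamma> - 1) * t powr (\<eta> - 1 + real k) * exp (- \<theta> * t))"
proof (rule set_integrable_bound)
  \<comment> \<open>The exponential factor is at most 1, so a Beta integrand is a majorant; it also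
    takes care of possible singularities at both ends.\<close>
  have "set_integrable lborel {0<..<1} (\<lambda>t. t powr (\<eta> + real k - 1) * (1 - t) powr (\<gamma> - 1))"
    by (rule set_integrable_subset[OF integrable_Beta]) (use assms in auto)
  then show "set_integrable lborel {0<..<1} (\<lambda>t. \<gamma> * (t powr (\<eta> + real k - 1) * (1 - t) powr (\<gamma> - 1)))"
    by simp
  show "set_borel_measurable lborel {0<..<1}
    (\<lambda>t. \<gamma> * (1 - t) powr (\<gamma> - 1) * t powr (\<eta> - 1 + real k) * exp (- \<theta> * t))"
    unfolding set_borel_measurable_def by measurable
  show "AE t in lborel. t \<in> {0<..<1} \<longrightarrow>
      norm (\<gamma> * (1 - t) powr (\<gamma> - 1) * t powr (\<eta> - 1 + real k) * exp (- \<theta> * t))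
      \<le> norm (\<gamma> * (t powr (\<eta> + real k - 1) * (1 - t) powr (\<gamma> - 1)))"
  proof (intro AE_I2 impI)
    fix t :: real assume "t \<in> {0<..<1}"
    then have "exp (- \<theta> * t) \<le> 1" using assms by simp
    then have "\<gamma> * (1 - t) powr (\<gamma> - 1) * t powr (\<eta> - 1 + real k) * exp (- \<theta> * t)
        \<le> \<gamma> * (1 - t) powr (\<gamma> - 1) * t powr (\<eta> - 1 + real k)"
      using assms by (intro mult_left_le) auto
    then show "norm (\<gamma> * (1 - t) powr (\<gamma> - 1) * t powr (\<eta> - 1 + real k) * exp (- \<theta> * t))
      \<le> norm (\<gamma> * (t powr (\<eta> + real k - 1) * (1 - t) powr (\<gamma> - 1)))"
      using assms by (simp add: abs_mult algebra_simps)
  qed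
qed

lemma A_integral_nonneg:
  assumes "\<gamma> > 0"
  shows "A_integral \<theta> \<gamma> \<eta> k \<ge> 0"
  unfolding A_integral_def set_lebesgue_integral_def
  using assms by (intro integral_nonneg_AE AE_I2) (auto simp: indicator_def)

text \<open>The integrand is strictly positive on the unit interval, so a zero integral would make
  that interval a null set.\<close>

lemma A_integral_pos:
  assumes "\<theta> \<ge> 0" "\<gamma> > 0" "\<eta> > 0"
  shows "A_integral \<theta> \<gamma> \<eta> k > 0"
proof -
  let ?f = "\<lambda>t. indicator {0<..<1} t *\<^sub>R
    (\<gamma> * (1 - t) powr (\<gamma> - 1) * t powr (\<eta> - 1 + real k) * exp (- \<theta> * t))"
  have "A_integral \<theta> \<gamma> \<eta> k \<noteq> 0"
  proof
    assume "A_integral \<theta> \<gamma> \<eta> k = 0"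
    then have "AE t in lborel. ?f t = 0"
      unfolding A_integral_def set_lebesgue_integral_def
      by (subst (asm) integral_nonneg_eq_0_iff_AE)
         (use assms set_integrable_A_integrand[OF assms, of k] in
           \<open>auto simp: indicator_def set_integrable_def intro!: AE_I2\<close>)
    then have "AE t in lborel. t \<notin> {0<..<1::real}"
      by eventually_elim (use assms in \<open>auto simp: indicator_def split: if_splits\<close>)
    then have "{0<..<1::real} \<in> null_sets lborel"
      by (subst (asm) AE_iff_null_sets[symmetric]) auto
    then show False by (simp add: null_sets_def)
  qed
  with A_integral_nonneg[of \<gamma> \<theta> \<eta> k] assms show ?thesis by linarith
qed

lemma A_integral_Suc_le:
  assumes "\<theta> \<ge> 0" "\<gamma> > 0" "\<eta> > 0"
  shows "A_integral \<theta> \<gamma> \<eta> (Suc k) \<le> A_integral \<theta> \<gamma> \<eta> k"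
  unfolding A_integral_def
proof (intro set_integral_mono set_integrable_A_integrand assms)
  fix t :: real assume t: "t \<in> {0<..<1}"
  then have "t powr (\<eta> - 1 + real (Suc k)) \<le> t powr (\<eta> - 1 + real k)"
    by (intro powr_mono') auto
  then show "\<gamma> * (1 - t) powr (\<gamma> - 1) * t powr (\<eta> - 1 + real (Suc k)) * exp (- \<theta> * t)
    \<le> \<gamma> * (1 - t) powr (\<gamma> - 1) * t powr (\<eta> - 1 + real k) * exp (- \<theta> * t)"
    using assms by (intro mult_right_mono mult_left_mono) auto
qed

text \<open>Integrate the derivative of \<open>\<gamma> * (1 - t) powr \<gamma> * t powr (\<eta> + k) * exp (- \<theta> * t)\<close>.\<close>
lemma A_integral_recurrence:
  assumes "\<theta> \<ge> 0" "\<gamma> > 0" "\<eta> > 0"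
  defines "A \<equiv> A_integral \<theta> \<gamma> \<eta>"
  shows "(\<eta> + real k) * (A k - A (Suc k)) - \<theta> * (A (Suc k) - A (Suc (Suc k))) = \<gamma> * A (Suc k)"
proof -
  define f where "f k t = \<gamma> * (1 - t) powr (\<gamma> - 1) * t powr (\<eta> - 1 + real k) * exp (- \<theta> * t)" for k t
  have int: "(f k has_integral A k) {0..1}" for k
  proof -
    have "(f k has_integral A k) {0<..<1}"
      using set_borel_integral_eq_integral[OF set_integrable_A_integrand[OF assms(1-3), of k]]
      unfolding A_def A_integral_def f_def by (auto simp: has_integral_integral)
    then show ?thesis by (simp add: has_integral_Icc_iff_Ioo)
  qed
  define F where "F t = \<gamma> * (1 - t) powr \<gamma> * t powr (\<eta> + real k) * exp (- \<theta> * t)" for t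
  define G where "G t = (\<eta> + real k) * (f k t - f (Suc k) t) -
    \<theta> * (f (Suc k) t - f (Suc (Suc k)) t) - \<gamma> * f (Suc k) t" for t
  have "(G has_integral ((\<eta> + real k) * (A k - A (Suc k)) -
      \<theta> * (A (Suc k) - A (Suc (Suc k))) - \<gamma> * A (Suc k))) {0..1}"
    unfolding G_def by (intro has_integral_diff has_integral_mult_right int)
  moreover have "(G has_integral (F 1 - F 0)) {0..1}"
  \<comment> \<open>\<open>G\<close> may be unbounded near an end point when an exponent of
    \<open>F\<close> is below 1, hence the interior version; \<open>F\<close> itself is continuous
    up to the ends because both exponents are positive.\<close>
  proof (rule fundamental_theorem_of_calculus_interior)
    show "continuous_on {0..1} F"
      unfolding F_def
      by (intro continuous_on_mult continuous_on_const continuous_on_powr' continuous_on_exp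
            continuous_on_diff continuous_on_id) (use assms in auto)
    fix t :: real assume t: "t \<in> {0<..<1}"
    \<comment> \<open>With the common factors \<open>a\<close> and \<open>b\<close> pulled out,
      matching the derivative with \<open>G\<close> becomes polynomial algebra in
      \<open>t\<close>.\<close>
    define a where "a = (1 - t) powr (\<gamma> - 1)"
    define b where "b = t powr (\<eta> + real k - 1)"
    have a: "(1 - t) powr \<gamma> = (1 - t) * a"
      using t by (simp add: a_def powr_diff)
    have b: "t powr (\<eta> + real k) = t * b" "t powr (\<eta> - 1 + real k) = b"
      "t powr (\<eta> - 1 + real (Suc k)) = t * b" "t powr (\<eta> - 1 + real (Suc (Suc k))) = t * t * b"
    proof -
      show "t powr (\<eta> + real k) = t * b" using t by (simp add: b_def powr_diff)
      show "t powr (\<eta> - 1 + real k) = b" by (simp add: b_def algebra_simps)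
      have "t powr (\<eta> - 1 + real (Suc k)) = t powr (1 + (\<eta> + real k - 1))"
        by (simp add: algebra_simps)
      then show "t powr (\<eta> - 1 + real (Suc k)) = t * b"
        using t unfolding b_def powr_add by simp
      have "t powr (\<eta> - 1 + real (Suc (Suc k))) = t powr (1 + 1 + (\<eta> + real k - 1))"
        by (simp add: algebra_simps)
      then show "t powr (\<eta> - 1 + real (Suc (Suc k))) = t * t * b"
        using t unfolding b_def powr_add by simp
    qed
    have d1: "((\<lambda>t. (1 - t) powr \<gamma>) has_real_derivative - (\<gamma> * a)) (at t)"
      using DERIV_chain'[of "\<lambda>t. 1 - t" "-1" t UNIV "\<lambda>z. z powr \<gamma>", OF _ has_real_derivative_powr] t
      by (auto simp: a_def intro!: derivative_eq_intros)
    have d2: "((\<lambda>t. t powr (\<eta> + real k)) has_real_derivative (\<eta> + real k) * b) (at t)"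
      using has_real_derivative_powr[of t "\<eta> + real k"] t by (simp add: b_def)
    have d3: "((\<lambda>t. exp (- \<theta> * t)) has_real_derivative - \<theta> * exp (- \<theta> * t)) (at t)"
      by (auto intro!: derivative_eq_intros)
    have "(F has_real_derivative
        (\<gamma> * - (\<gamma> * a) * t powr (\<eta> + real k) + (\<eta> + real k) * b * (\<gamma> * (1 - t) powr \<gamma>)) *
          exp (- \<theta> * t) + - \<theta> * exp (- \<theta> * t) * (\<gamma> * (1 - t) powr \<gamma> * t powr (\<eta> + real k))) (at t)"
      unfolding F_def by (intro DERIV_mult DERIV_cmult d1 d2 d3)
    also have "(\<gamma> * - (\<gamma> * a) * t powr (\<eta> + real k) + (\<eta> + real k) * b * (\<gamma> * (1 - t) powr \<gamma>)) *
          exp (- \<theta> * t) + - \<theta> * exp (- \<theta> * t) * (\<gamma> * (1 - t) powr \<gamma> * t powr (\<eta> + real k)) = G t"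
      unfolding G_def f_def a b a_def[symmetric] by (simp add: algebra_simps)
    finally show "(F has_vector_derivative G t) (at t)"
      by (simp add: has_real_derivative_iff_has_vector_derivative)
  qed simp
  moreover have "F 1 - F 0 = 0" using assms by (simp add: F_def)
  ultimately show ?thesis
    by (metis has_integral_unique diff_eq_eq add_0)
qed

section \<open>Weights of the queue without resets\<close>

lemma embed_pmf_sums:
  fixes f :: "nat \<Rightarrow> real"
  assumes "\<And>k. f k \<ge> 0" "f sums 1"
  shows "pmf (embed_pmf f) k = f k"
proof (rule pmf_embed_pmf)
  show "(\<integral>\<^sup>+k. ennreal (f k) \<partial>count_space UNIV) = 1"
    using assms by (simp add: nn_integral_count_space_nat suminf_ennreal2 sums_iff)
qed (use assms in auto)

text \<open>For \<open>\<theta> = lam / \<nu>\<close> and \<open>\<eta> = \<mu> / \<nu>\<close> this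
  is the unnormalised stationary law of the queue with resetting switched off.\<close>

definition birth_death_weight :: "real \<Rightarrow> real \<Rightarrow> nat \<Rightarrow> real" where
  "birth_death_weight \<theta> \<eta> k = \<theta> ^ k / (\<Prod>i<k. real i + \<eta>)"

lemma birth_death_weight_0 [simp]: "birth_death_weight \<theta> \<eta> 0 = 1"
  by (simp add: birth_death_weight_def)

text \<open>Detailed balance between \<open>k\<close> and \<open>k + 1\<close> in the queue without
  resets, divided by \<open>\<nu>\<close>.\<close>

lemma birth_death_weight_Suc:
  assumes "\<eta> > 0"
  shows "(\<eta> + real k) * birth_death_weight \<theta> \<eta> (Suc k) = \<theta> * birth_death_weight \<theta> \<eta> k"
proof -
  have "real k + \<eta> \<noteq> 0" using assms by linarith
  then show ?thesis by (simp add: birth_death_weight_def add.commute)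
qed

lemma birth_death_weight_nonneg:
  assumes "\<theta> \<ge> 0" "\<eta> > 0"
  shows "birth_death_weight \<theta> \<eta> k \<ge> 0"
  using assms by (auto simp: birth_death_weight_def intro!: divide_nonneg_nonneg prod_nonneg)

lemma summable_birth_death_weight:
  assumes "\<theta> \<ge> 0" "\<eta> > 0"
  shows "summable (birth_death_weight \<theta> \<eta>)"
proof (rule summable_ratio_test[where c = "1/2" and N = "nat \<lceil>2 * \<theta>\<rceil>"])
  fix k assume "k \<ge> nat \<lceil>2 * \<theta>\<rceil>"
  \<comment> \<open>From here on the ratio of successive weights,
    \<open>\<theta> / (\<eta> + k)\<close>, is at most one half.\<close>
  then have k: "2 * \<theta> \<le> real k" by linarith
  have "2 * \<theta> * birth_death_weight \<theta> \<eta> (Suc k) \<le> (\<eta> + real k) * birth_death_weight \<theta> \<eta> (Suc k)"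
    using k assms by (intro mult_right_mono birth_death_weight_nonneg) auto
  also have "\<dots> = \<theta> * birth_death_weight \<theta> \<eta> k"
    using assms by (simp add: birth_death_weight_Suc)
  finally have *: "2 * \<theta> * birth_death_weight \<theta> \<eta> (Suc k) \<le> \<theta> * birth_death_weight \<theta> \<eta> k" .
  show "norm (birth_death_weight \<theta> \<eta> (Suc k)) \<le> 1/2 * norm (birth_death_weight \<theta> \<eta> k)"
  proof (cases "\<theta> = 0")
    case False
    then have "2 * birth_death_weight \<theta> \<eta> (Suc k) \<le> birth_death_weight \<theta> \<eta> k"
      using * assms by (simp add: mult.assoc mult.left_commute[of 2])
    then show ?thesis
      using birth_death_weight_nonneg[OF assms] by simp
  qed (simp add: birth_death_weight_def)
qed simp

text \<open>Detailed balance gives \<open>(k + 1) * w (k + 1) = \<theta> * w k + (1 - \<eta>) * w (k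
  + 1)\<close> for the weights \<open>w\<close>, so the first moment reduces to plain summability.
  It is needed because the exit rates grow linearly.\<close>

lemma summable_real_mult_birth_death_weight:
  assumes "\<theta> \<ge> 0" "\<eta> > 0"
  shows "summable (\<lambda>k. real k * birth_death_weight \<theta> \<eta> k)"
proof -
  have "summable (\<lambda>k. \<theta> * birth_death_weight \<theta> \<eta> k + (1 - \<eta>) * birth_death_weight \<theta> \<eta> (Suc k))"
    using assms by (intro summable_add summable_mult summable_birth_death_weight)
      (use assms summable_birth_death_weight in \<open>simp_all add: summable_Suc_iff\<close>)
  also have "(\<lambda>k. \<theta> * birth_death_weight \<theta> \<eta> k + (1 - \<eta>) * birth_death_weight \<theta> \<eta> (Suc k)) =
      (\<lambda>k. real (Suc k) * birth_death_weight \<theta> \<eta> (Suc k))"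
    using assms by (simp add: birth_death_weight_Suc[symmetric] algebra_simps)
  finally show ?thesis by (subst (asm) summable_Suc_iff)
qed

section \<open>Rates and balance equations of the reset queue\<close>

lemma integrable_measure_pmf_nat_iff:
  fixes f :: "nat \<Rightarrow> real"
  shows "integrable (measure_pmf p) f \<longleftrightarrow> summable (\<lambda>i. pmf p i * \<bar>f i\<bar>)"
  by (simp add: measure_pmf_eq_density integrable_density integrable_count_space_nat_iff abs_mult)

lemma expectation_pmf_nat_sums:
  fixes f :: "nat \<Rightarrow> real"
  assumes "integrable (measure_pmf p) f"
  shows "(\<lambda>i. pmf p i * f i) sums measure_pmf.expectation p f"
  using assms sums_integral_count_space_nat[of "\<lambda>i. pmf p i * f i"]
  by (simp add: measure_pmf_eq_density integrable_density integral_density)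

text \<open>Removing \<open>i\<close> discards the spurious targets at state 0, where truncated
  subtraction gives \<open>0 - 1 = 0\<close>. At state 1 the departure and reset targets
  coincide.\<close>

definition reset_queue_neighbours :: "nat \<Rightarrow> nat set" where
  "reset_queue_neighbours i = {i + 1, i - 1, 0} - {i}"

text \<open>Splitting the rate into its three mechanisms before summing makes the coinciding targets
  at state 1 add up. Constant \<open>v\<close> gives the exit rate, and differences of
  \<open>u\<close> give the generator.\<close>

lemma reset_queue_rate_sum:
  "(\<Sum>j\<in>reset_queue_neighbours i. reset_queue_rate lam \<mu> \<nu> \<kappa> i j * v j) =
    lam * v (i + 1) + (if i \<ge> 1 then (\<mu> + (real i - 1) * \<nu>) * v (i - 1) + \<kappa> * v 0 else 0)"
proof -
  let ?S = "reset_queue_neighbours i"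
  have "(\<Sum>j\<in>?S. reset_queue_rate lam \<mu> \<nu> \<kappa> i j * v j) =
      (\<Sum>j\<in>?S. (if j = i + 1 then lam * v j else 0) +
        ((if j = i - 1 then if i \<ge> 1 then (\<mu> + (real i - 1) * \<nu>) * v j else 0 else 0) +
         (if j = 0 then if i \<ge> 1 then \<kappa> * v j else 0 else 0)))"
    by (intro sum.cong) (auto simp: reset_queue_rate_def algebra_simps)
  also have "\<dots> = lam * v (i + 1) +
      (if i \<ge> 1 then (\<mu> + (real i - 1) * \<nu>) * v (i - 1) + \<kappa> * v 0 else 0)"
    unfolding sum.distrib by (auto simp: reset_queue_neighbours_def sum.delta)
  finally show ?thesis .
qed

text \<open>
  The hypothesis \<open>cut\<close> balances the flow across the cut between \<open>{0..k}\<close> and \<open>{k + 1..}\<close>, with \<open>T k\<close>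
  the mass above the cut. It makes the sum telescope, leaving boundary terms only.
\<close>
lemma reset_queue_balance_telescope:
  fixes r T u :: "nat \<Rightarrow> real"
  assumes cut: "\<And>k. lam * r k = (\<mu> + real k * \<nu>) * r (Suc k) + \<kappa> * T k"
    and T: "\<And>k. T k - T (Suc k) = r (Suc k)"
  shows "(\<Sum>i\<le>n. r i * (lam * (u (i + 1) - u i) +
      (if i \<ge> 1 then (\<mu> + (real i - 1) * \<nu>) * (u (i - 1) - u i) + \<kappa> * (u 0 - u i) else 0))) =
    \<kappa> * T n * (u n - u 0) + lam * r n * (u (Suc n) - u n)"
proof (induction n)
  case (Suc n)
  have T': "T n = T (Suc n) + r (Suc n)" using T[of n] by simp
  show ?case
    unfolding sum.atMost_Suc Suc.IH cut[of n] T'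
    by (simp add: algebra_simps)
qed simp

text \<open>The cut equations reduce the generator identity to boundary terms, which vanish as
  \<open>T\<close> and \<open>pmf p\<close> tend to 0; the first moment makes the exit rates
  integrable.\<close>

lemma stationary_distribution_reset_queueI:
  fixes T :: "nat \<Rightarrow> real"
  assumes P: "ctmc_with_rates (reset_queue_rate lam \<mu> \<nu> \<kappa>) P"
    and nonneg: "lam \<ge> 0" "\<mu> \<ge> 0" "\<nu> \<ge> 0" "\<kappa> \<ge> 0"
    and cut: "\<And>k. lam * pmf p k = (\<mu> + real k * \<nu>) * pmf p (Suc k) + \<kappa> * T k"
    and T: "\<And>k. T k - T (Suc k) = pmf p (Suc k)" "T \<longlonglongrightarrow> 0"
    and mean: "summable (\<lambda>k. real k * pmf p k)"
  shows "stationary_distribution P p"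
proof (rule stationary_distributionI[OF P, where S = reset_queue_neighbours])
  let ?q = "reset_queue_rate lam \<mu> \<nu> \<kappa>" and ?S = reset_queue_neighbours
  show "finite (?S i)" "i \<notin> ?S i" for i
    by (auto simp: reset_queue_neighbours_def)
  show "?q i j = 0" if "j \<notin> ?S i" "j \<noteq> i" for i j
    using that by (auto simp: reset_queue_neighbours_def reset_queue_rate_def)
  have q0: "?q i j \<ge> 0" for i j
    using nonneg by (auto simp: reset_queue_rate_def)
  have "summable (\<lambda>i. (lam + \<mu> + \<kappa>) * pmf p i + \<nu> * (real i * pmf p i))"
    using mean integrable_measure_pmf_nat_iff[of p "\<lambda>_. 1"]
    by (intro summable_add summable_mult) auto
  then have "integrable (measure_pmf p) (\<lambda>i. (lam + \<mu> + \<kappa>) + \<nu> * real i)"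
    using nonneg by (simp add: integrable_measure_pmf_nat_iff algebra_simps)
  then show int: "integrable (measure_pmf p) (\<lambda>i. \<Sum>j\<in>?S i. ?q i j)"
  proof (rule Bochner_Integration.integrable_bound)
    have "(\<Sum>j\<in>?S i. ?q i j) \<le> (lam + \<mu> + \<kappa>) + \<nu> * real i" for i
      using reset_queue_rate_sum[of lam \<mu> \<nu> \<kappa> i "\<lambda>_. 1"] nonneg by (auto simp: algebra_simps)
    then show "AE i in measure_pmf p. norm (\<Sum>j\<in>?S i. ?q i j) \<le> norm ((lam + \<mu> + \<kappa>) + \<nu> * real i)"
      using q0 by (intro AE_I2) (simp add: abs_of_nonneg sum_nonneg order_trans[OF _ abs_ge_self])
  qed simp
  fix u :: "nat \<Rightarrow> real" assume u: "\<And>k. 0 \<le> u k \<and> u k \<le> 1"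
  have u1: "\<bar>u j - u i\<bar> \<le> 1" for i j using u[of i] u[of j] by linarith
  let ?Q = "\<lambda>i. \<Sum>j\<in>?S i. ?q i j * (u j - u i)"
  have "\<bar>?Q i\<bar> \<le> (\<Sum>j\<in>?S i. ?q i j)" for i
  proof (intro order_trans[OF sum_abs] sum_mono)
    fix j show "\<bar>?q i j * (u j - u i)\<bar> \<le> ?q i j"
      using u1[of j i] q0[of i j] by (simp add: abs_mult mult_left_le)
  qed
  then have "integrable (measure_pmf p) ?Q"
    by (intro Bochner_Integration.integrable_bound[OF int])
       (auto intro!: AE_I2 order_trans[OF _ abs_ge_self])
  from expectation_pmf_nat_sums[OF this]
  have "(\<lambda>n. \<Sum>i\<le>n. pmf p i * ?Q i) \<longlonglongrightarrow> measure_pmf.expectation p ?Q"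
    by (simp add: sums_def_le)
  moreover have "(\<lambda>n. \<Sum>i\<le>n. pmf p i * ?Q i) =
      (\<lambda>n. \<kappa> * T n * (u n - u 0) + lam * pmf p n * (u (Suc n) - u n))"
    unfolding reset_queue_rate_sum
    by (rule ext) (rule reset_queue_balance_telescope[OF cut T(1)])
  moreover have "\<dots> \<longlonglongrightarrow> 0"
  proof (rule Lim_null_comparison)
    have "pmf p \<longlonglongrightarrow> 0"
      using integrable_measure_pmf_nat_iff[of p "\<lambda>_. 1"] by (intro summable_LIMSEQ_zero) auto
    then have "(\<lambda>n. \<kappa> * \<bar>T n\<bar> + lam * pmf p n) \<longlonglongrightarrow> \<kappa> * \<bar>0\<bar> + lam * 0"
      by (intro tendsto_intros T(2))
    then show "(\<lambda>n. \<kappa> * \<bar>T n\<bar> + lam * pmf p n) \<longlonglongrightarrow> 0" by simp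
    show "eventually (\<lambda>n. norm (\<kappa> * T n * (u n - u 0) + lam * pmf p n * (u (Suc n) - u n)) \<le>
      \<kappa> * \<bar>T n\<bar> + lam * pmf p n) sequentially"
    proof (intro always_eventually allI)
      fix n
      have "\<bar>\<kappa> * T n * (u n - u 0)\<bar> \<le> \<kappa> * \<bar>T n\<bar>"
        using nonneg u1[of n 0] by (simp add: abs_mult mult_left_le)
      moreover have "\<bar>lam * pmf p n * (u (Suc n) - u n)\<bar> \<le> lam * pmf p n"
        using nonneg u1[of "Suc n" n] by (simp add: abs_mult mult_left_le)
      ultimately show "norm (\<kappa> * T n * (u n - u 0) + lam * pmf p n * (u (Suc n) - u n)) \<le>
          \<kappa> * \<bar>T n\<bar> + lam * pmf p n"
        by (auto intro: order_trans[OF abs_triangle_ineq])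
    qed
  qed
  ultimately show "measure_pmf.expectation p ?Q = 0"
    using LIMSEQ_unique by fastforce
qed

text \<open>A reset leads to 0 in one jump from every other state; from 0 itself, the probability of
  being at 0 tends to 1 at small times.\<close>

lemma reset_queue_reaches_0:
  assumes "ctmc_with_rates (reset_queue_rate lam \<mu> \<nu> \<kappa>) P"
    and "\<mu> \<ge> 0" "\<nu> \<ge> 0" "\<kappa> > 0"
  shows "eventually (\<lambda>h. pmf (P h i) 0 > 0) (at_right 0)"
proof (cases "i = 0")
  case True
  obtain c where c: "((\<lambda>h. (1 - pmf (P h i) i) / h) \<longlongrightarrow> c) (at_right 0)"
    using assms(1) by (auto simp: ctmc_with_rates_def has_jump_rates_def)
  \<comment> \<open>Continuity at 0 is recovered from the finite exit slope.\<close>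
  have "((\<lambda>h. 1 - (1 - pmf (P h i) i) / h * h) \<longlongrightarrow> 1 - c * 0) (at_right 0)"
    by (intro tendsto_intros c)
  then have "eventually (\<lambda>h. 1 - (1 - pmf (P h i) i) / h * h > 0) (at_right 0)"
    by (rule order_tendstoD) simp
  with eventually_at_right_less[of 0] show ?thesis
    by eventually_elim (simp add: True)
next
  case False
  then have "reset_queue_rate lam \<mu> \<nu> \<kappa> i 0 > 0"
    using assms by (auto simp: reset_queue_rate_def intro: add_nonneg_pos)
  moreover have "((\<lambda>h. pmf (P h i) 0 / h) \<longlongrightarrow> reset_queue_rate lam \<mu> \<nu> \<kappa> i 0) (at_right 0)"
    using assms(1) False by (simp add: ctmc_with_rates_def has_jump_rates_def)
  ultimately have "eventually (\<lambda>h. pmf (P h i) 0 / h > 0) (at_right 0)"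
    by (rule order_tendstoD(1)[rotated])
  with eventually_at_right_less[of 0] show ?thesis
    by eventually_elim (simp add: zero_less_divide_iff)
qed

section \<open>Normalisation and stationarity of the closed form\<close>

theorem theorem3p2:
  fixes lam \<mu> \<nu> \<kappa> \<theta> \<gamma> \<eta> :: real
    and A :: "nat \<Rightarrow> real"
    and P :: "real \<Rightarrow> nat \<Rightarrow> nat pmf"
  assumes "lam \<ge> 0" and "\<mu> > 0" and "\<nu> > 0" and "\<kappa> > 0"
    and "\<theta> = lam / \<nu>" and "\<gamma> = \<kappa> / \<nu>" and "\<eta> = \<mu> / \<nu>"
    and "\<And>k. A k = A_integral \<theta> \<gamma> \<eta> k"
    and "ctmc_with_rates (reset_queue_rate lam \<mu> \<nu> \<kappa>) P"
  shows "(\<exists>!p. stationary_distribution P p) \<and>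
    (\<forall>p. stationary_distribution P p \<longrightarrow>
      (\<forall>k. pmf p k = \<theta> ^ k / (\<Prod>i<k. real i + \<eta>) *
                      (\<gamma> * A k / ((\<gamma> + \<theta>) * A 0 - \<theta> * A 1))))"
proof -
  define w where "w = birth_death_weight \<theta> \<eta>"
  define N where "N = (\<gamma> + \<theta>) * A 0 - \<theta> * A 1"
  define r where "r k = w k * (\<gamma> * A k / N)" for k
  define T where "T k = \<theta> * w k * (A k - A (Suc k)) / N" for k
  have pos: "\<theta> \<ge> 0" "\<gamma> > 0" "\<eta> > 0" using assms(1-7) by auto
  have A: "A k = A_integral \<theta> \<gamma> \<eta> k" for k by fact
  have A0: "A k > 0" for k unfolding A by (rule A_integral_pos[OF pos])
  have A_Suc: "A (Suc k) \<le> A k" for k unfolding A by (rule A_integral_Suc_le[OF pos])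
  have A_le: "A k \<le> A 0" for k by (rule decseqD) (simp_all add: decseq_Suc_iff A_Suc)
  have w0: "w k \<ge> 0" for k unfolding w_def using pos by (simp add: birth_death_weight_nonneg)
  have w_Suc: "(\<eta> + real k) * w (Suc k) = \<theta> * w k" for k
    unfolding w_def using pos by (simp add: birth_death_weight_Suc)
  have N: "N > 0"
  proof -
    \<comment> \<open>\<open>N\<close> equals
      \<open>\<gamma> * A 0 + \<theta> * (A 0 - A 1)\<close>, a positive term plus a nonnegative
      one.\<close>
    have "\<theta> * A 1 \<le> \<theta> * A 0" using A_Suc[of 0] pos by (intro mult_left_mono) auto
    moreover have "\<gamma> * A 0 > 0" using A0 pos by simp
    ultimately show ?thesis by (simp add: N_def algebra_simps)
  qed
  have T_Suc: "T k - T (Suc k) = r (Suc k)" for k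
  proof -
    have "T k - T (Suc k) = (\<theta> * w k * (A k - A (Suc k)) -
        \<theta> * w (Suc k) * (A (Suc k) - A (Suc (Suc k)))) / N"
      by (simp add: T_def diff_divide_distrib)
    \<comment> \<open>Trading \<open>\<theta> * w k\<close> for
      \<open>(\<eta> + k) * w (Suc k)\<close> produces the left-hand side of the recurrence for
      \<open>A\<close>.\<close>
    also have "\<dots> = w (Suc k) * ((\<eta> + real k) * (A k - A (Suc k)) -
        \<theta> * (A (Suc k) - A (Suc (Suc k)))) / N"
      unfolding w_Suc[of k, symmetric] by (simp add: algebra_simps)
    also have "\<dots> = r (Suc k)"
      unfolding r_def A A_integral_recurrence[OF pos] by simp
    finally show ?thesis .
  qed
  \<comment> \<open>The value of \<open>N\<close> enters only through the base case
    \<open>r 0 + T 0 = 1\<close>.\<close>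
  have r_T: "(\<Sum>i\<le>n. r i) = 1 - T n" for n
  proof (induction n)
    case 0
    have "r 0 + T 0 = ((\<gamma> + \<theta>) * A 0 - \<theta> * A 1) / N"
      by (simp add: r_def T_def w_def add_divide_distrib[symmetric] algebra_simps)
    also have "\<dots> = 1" using N by (simp add: N_def)
    finally show ?case by simp
  next
    case (Suc n)
    with T_Suc[of n] show ?case by simp
  qed
  have T_lim: "T \<longlonglongrightarrow> 0"
  proof (rule Lim_null_comparison)
    have "w \<longlonglongrightarrow> 0"
      unfolding w_def by (intro summable_LIMSEQ_zero summable_birth_death_weight pos)
    then have "(\<lambda>k. \<theta> * w k * A 0 / N) \<longlonglongrightarrow> \<theta> * 0 * A 0 / N"
      using N by (intro tendsto_intros) auto
    then show "(\<lambda>k. \<theta> * w k * A 0 / N) \<longlonglongrightarrow> 0" by simp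
    have "\<bar>T k\<bar> \<le> \<theta> * w k * A 0 / N" for k
    proof -
      have "0 \<le> A k - A (Suc k)" "A k - A (Suc k) \<le> A 0"
        using A_Suc[of k] A_le[of k] A0[of "Suc k"] by auto
      then show ?thesis
        using w0[of k] pos N unfolding T_def
        by (auto simp: abs_mult intro!: divide_right_mono mult_left_mono)
    qed
    then show "eventually (\<lambda>k. norm (T k) \<le> \<theta> * w k * A 0 / N) sequentially" by simp
  qed
  have r0: "r k \<ge> 0" for k
    unfolding r_def using w0 A0[of k] N pos by (intro mult_nonneg_nonneg divide_nonneg_nonneg) auto
  have "r sums 1"
    unfolding sums_def_le r_T using tendsto_diff[OF tendsto_const T_lim, of 1] by simp
  define p where "p = embed_pmf r"
  have p: "pmf p k = r k" for k
    unfolding p_def by (rule embed_pmf_sums[OF r0 \<open>r sums 1\<close>])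
  have "stationary_distribution P p"
  proof (rule stationary_distribution_reset_queueI[OF assms(9)])
    show "lam * pmf p k = (\<mu> + real k * \<nu>) * pmf p (Suc k) + \<kappa> * T k" for k
    proof -
      have rates: "lam = \<nu> * \<theta>" "\<mu> = \<nu> * \<eta>" "\<kappa> = \<nu> * \<gamma>" using assms(3,5-7) by simp_all
      have "(\<mu> + real k * \<nu>) * pmf p (Suc k) = \<nu> * ((\<eta> + real k) * w (Suc k)) * (\<gamma> * A (Suc k) / N)"
        by (simp add: p r_def rates algebra_simps add_divide_distrib)
      \<comment> \<open>Departures contribute \<open>A (Suc k)\<close> and resets
        \<open>A k - A (Suc k)\<close>; together they give the \<open>A k\<close> of the arrival
        flow.\<close>
      also have "\<dots> + \<kappa> * T k = \<nu> * \<theta> * w k * \<gamma> * (A (Suc k) + (A k - A (Suc k))) / N"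
        unfolding w_Suc T_def rates by (simp add: algebra_simps add_divide_distrib diff_divide_distrib)
      also have "\<dots> = lam * pmf p k"
        by (simp add: p r_def rates)
      finally show ?thesis by simp
    qed
    \<comment> \<open>Since \<open>A k \<le> A 0\<close>, the first moment is dominated by that of
      the weights.\<close>
    have "summable (\<lambda>k. real k * w k * (\<gamma> * A 0 / N))"
      unfolding w_def by (intro summable_mult2 summable_real_mult_birth_death_weight pos)
    then show "summable (\<lambda>k. real k * pmf p k)"
    proof (rule summable_comparison_test_ev[rotated])
      have "real k * r k \<le> real k * w k * (\<gamma> * A 0 / N)" for k
        unfolding r_def mult.assoc
        using w0[of k] A_le[of k] pos N
        by (intro mult_left_mono divide_right_mono) auto
      then show "eventually (\<lambda>k. norm (real k * pmf p k) \<le> real k * w k * (\<gamma> * A 0 / N)) sequentially"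
        using r0 by (intro always_eventually) (simp add: p abs_mult)
    qed
  qed (use assms(1-4) T_Suc T_lim in \<open>auto simp: p\<close>)
  moreover have "p' = p''" if "stationary_distribution P p'" "stationary_distribution P p''" for p' p''
    by (rule stationary_distribution_unique[OF _ that], rule reset_queue_reaches_0[OF assms(9)])
       (use assms in auto)
  moreover have "pmf p k = \<theta> ^ k / (\<Prod>i<k. real i + \<eta>) *
      (\<gamma> * A k / ((\<gamma> + \<theta>) * A 0 - \<theta> * A 1))" for k
    unfolding p r_def w_def N_def birth_death_weight_def ..
  ultimately show ?thesis by metis
qed

end
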